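(* Let $d\ge2$, let $\{P_i\}_{i\in V_P}$ be a finite nonempty family of finite index sets (patches), and let $\{\mathbf{t}_k\}_{k\in\bigcup P_i}\subseteq\mathbb{R}^d$ be pairwise distinct global locations. Let $\{\mathbf{t}^i_k\}_{k\in P_i,\,i\in V_P}\subseteq\mathbb{R}^d$ be (noiseless) local coordinates corresponding to the global locations, i.e. there are signed scales $c^i\in\mathbb{R}\setminus\{0\}$ and translations $\mathbf{t}^i\in\mathbb{R}^d$, $i\in V_P$, with $$\mathbf{t}_k=c^i\mathbf{t}_k^i+\mathbf{t}^i\qquad\text{for all }k\in P_i,\ i\in V_P.$$ Let $G_P=(V_P,E_P)$ be the graph on the patches in which, for $i\neq j$, $(i,j)\in E_P$ if and only if $|P_i\cap P_j|\ge2$, and assume that $G_P$ is connected. Then the two step global location construction algorithm, provided with the noiseless local coordinates ($\hat{\mathbf{t}}_k^i=\mathbf{t}_k^i$), recovers the global locations exactly, in the sense that any solution $\{\mathbf{y}_k\}_{k\in\bigcup P_i}$ for the global locations produced by the algorithm is congruent to $\{\mathbf{t}_k\}_{k\in\bigcup P_i}$.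
   Context: Two step global location construction algorithm, with input $\{\hat{\mathbf{t}}_k^i\}_{k\in P_i,\,i\in V_P}$: Step 1 (patch signs). For each edge $(i,j)\in E_P$ take a minimizer $((c^{ij})^*,(\mathbf{t}^{ij})^* )$ of $$\min_{c^{ij}\in\mathbb{R},\ \mathbf{t}^{ij}\in\mathbb{R}^d}\ \sum_{k\in P_i\cap P_j}\big\|\hat{\mathbf{t}}_k^i-(c^{ij}\hat{\mathbf{t}}_k^j+\mathbf{t}^{ij})\big\|_2^2$$ and set the relative sign estimate $\hat z^{ij}=\hat z^{ji}=\mathrm{sign}((c^{ij})^* )\in\{-1,+1\}$. The patch signs $\hat z^i\in\{-1,+1\}$, $i\in V_P$, are then computed by the eigenvector method (EVM): let $Z$ be the symmetric $|V_P|\times|V_P|$ matrix with $Z_{ij}=\hat z^{ij}$ for $(i,j)\in E_P$ and $0$ otherwise, let $D$ be the diagonal matrix of vertex degrees of $G_P$, take an eigenvector $v$ of $D^{-1}Z$ for its largest eigenvalue and put $\hat z^i=\mathrm{sign}(v_i)$. (If $|V_P|=1$, the single sign is an arbitrary element of $\{-1,+1\}$.) Step 2 (global stitching). With these signs, solve the convex program over all variables $\mathbf{t}_k\in\mathbb{R}^d$ ($k\in\bigcup P_i$), $c^i\in\mathbb{R}$, $\mathbf{t}^i\in\mathbb{R}^d$ ($i\in V_P$): $$\min\ \sum_{i\in V_P}\sum_{k\in P_i}\big\|\mathbf{t}_k-(c^i\hat z^i\hat{\mathbf{t}}_k^i+\mathbf{t}^i)\big\|_2\quad\text{subject to}\quad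 c^i\ge1\ \ \forall i\in V_P.$$ The output is the family of $\mathbf{t}_k$-components $\{\mathbf{y}_k\}$ of any minimizer. Congruence: $\{\mathbf{p}_k\}$ and $\{\mathbf{q}_k\}$ in $\mathbb{R}^d$ are congruent if there are $c\in\mathbb{R}\setminus\{0\}$ and $\mathbf{x}\in\mathbb{R}^d$ with $\mathbf{q}_k=c\mathbf{p}_k+\mathbf{x}$ for all $k$. *)

theory Defs
  imports "HOL-Analysis.Analysis" "Graph_Theory.Digraph_Component"
begin

text \<open>
  Patches are indexed by a type \<open>'v\<close> of class \<^class>\<open>finite\<close> (the vertex set $V_P$; types are
  nonempty), points by an arbitrary type \<open>'k\<close>. Families indexed by a subset of these types are
  total functions whose values outside that subset are never used.
\<close>

text \<open>Undirected graphs are represented as in \<^theory>\<open>Graph_Theory.Digraph_Component\<close>: by a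
  symmetric set of arcs. The degree of a vertex is then its out-degree.\<close>

definition patch_graph :: "('v \<Rightarrow> 'k set) \<Rightarrow> 'v pair_pre_digraph" where
  "patch_graph P = \<lparr> pverts = UNIV, parcs = {(i, j). i \<noteq> j \<and> 2 \<le> card (P i \<inter> P j)} \<rparr>"

definition local_coordinates ::
    "('v \<Rightarrow> 'k set) \<Rightarrow> ('k \<Rightarrow> real ^ 'd) \<Rightarrow> ('v \<Rightarrow> 'k \<Rightarrow> real ^ 'd) \<Rightarrow> bool" where
  "local_coordinates P t tloc \<longleftrightarrow>
     (\<exists>(c :: 'v \<Rightarrow> real) (s :: 'v \<Rightarrow> real ^ 'd).
        (\<forall>i. c i \<noteq> 0) \<and> (\<forall>i. \<forall>k \<in> P i. t k = c i *\<^sub>R tloc i k + s i))"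

definition congruent_locations ::
    "'k set \<Rightarrow> ('k \<Rightarrow> real ^ 'd) \<Rightarrow> ('k \<Rightarrow> real ^ 'd) \<Rightarrow> bool" where
  "congruent_locations K p q \<longleftrightarrow>
     (\<exists>(c :: real) (x :: real ^ 'd). c \<noteq> 0 \<and> (\<forall>k \<in> K. q k = c *\<^sub>R p k + x))"

text \<open>The sign function of the algorithm takes values in $\{-1, +1\}$; either value is admitted
  for the sign of 0, so that every tie-breaking rule is covered.\<close>

definition is_sign :: "real \<Rightarrow> real \<Rightarrow> bool" where
  "is_sign x z \<longleftrightarrow> z \<in> {-1, 1} \<and> (x \<noteq> 0 \<longrightarrow> z = sgn x)"


subsection \<open>Step 1: patch signs\<close>

definition alignment_cost ::
    "('v \<Rightarrow> 'k set) \<Rightarrow> ('v \<Rightarrow> 'k \<Rightarrow> real ^ 'd) \<Rightarrow> 'v \<Rightarrow> 'v \<Rightarrow> real \<times> (real ^ 'd) \<Rightarrow> real" where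
  "alignment_cost P tloc i j = (\<lambda>(c, s). \<Sum>k \<in> P i \<inter> P j. (norm (tloc i k - (c *\<^sub>R tloc j k + s)))\<^sup>2)"

definition pairwise_sign ::
    "('v \<Rightarrow> 'k set) \<Rightarrow> ('v \<Rightarrow> 'k \<Rightarrow> real ^ 'd) \<Rightarrow> 'v \<Rightarrow> 'v \<Rightarrow> real \<Rightarrow> bool" where
  "pairwise_sign P tloc i j z \<longleftrightarrow>
     (\<exists>c s. is_arg_min (alignment_cost P tloc i j) (\<lambda>_. True) (c, s) \<and> is_sign c z)"

text \<open>The least squares problem is not symmetric in $i$ and $j$. It is solved once for each
  undirected edge, in either orientation, and the resulting sign is used for both orientations.\<close>

definition relative_signs ::
    "('v \<Rightarrow> 'k set) \<Rightarrow> ('v \<Rightarrow> 'k \<Rightarrow> real ^ 'd) \<Rightarrow> ('v \<Rightarrow> 'v \<Rightarrow> real) \<Rightarrow> bool" where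
  "relative_signs P tloc zr \<longleftrightarrow>
     (\<forall>(i, j) \<in> parcs (patch_graph P).
        zr i j = zr j i \<and> (pairwise_sign P tloc i j (zr i j) \<or> pairwise_sign P tloc j i (zr i j)))"

definition sign_matrix :: "('v \<Rightarrow> 'k set) \<Rightarrow> ('v \<Rightarrow> 'v \<Rightarrow> real) \<Rightarrow> real ^ 'v ^ 'v" where
  "sign_matrix P zr = (\<chi> i j. if (i, j) \<in> parcs (patch_graph P) then zr i j else 0)"

definition degree_matrix :: "('v \<Rightarrow> 'k set) \<Rightarrow> real ^ 'v ^ 'v" where
  "degree_matrix P =
     (\<chi> i j. if i = j then real (out_degree (with_proj (patch_graph P)) i) else 0)"

definition is_eigenvector :: "real ^ 'n ^ 'n \<Rightarrow> real ^ 'n \<Rightarrow> real \<Rightarrow> bool" where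
  "is_eigenvector A v l \<longleftrightarrow> v \<noteq> 0 \<and> A *v v = l *\<^sub>R v"

definition is_top_eigenvector :: "real ^ 'n ^ 'n \<Rightarrow> real ^ 'n \<Rightarrow> bool" where
  "is_top_eigenvector A v \<longleftrightarrow>
     (\<exists>l. is_eigenvector A v l \<and> (\<forall>m. (\<exists>w. is_eigenvector A w m) \<longrightarrow> m \<le> l))"

text \<open>The case distinction is part of the algorithm: for a single patch the degree matrix is 0
  and not invertible.\<close>

definition patch_signs ::
    "('v::finite \<Rightarrow> 'k set) \<Rightarrow> ('v \<Rightarrow> 'k \<Rightarrow> real ^ 'd) \<Rightarrow> ('v \<Rightarrow> real) \<Rightarrow> bool" where
  "patch_signs P tloc z \<longleftrightarrow>
     (if CARD('v) = 1 then \<forall>i. z i \<in> {-1, 1}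
      else \<exists>zr v. relative_signs P tloc zr \<and>
             is_top_eigenvector (matrix_inv (degree_matrix P) ** sign_matrix P zr) v \<and>
             (\<forall>i. is_sign (v $ i) (z i)))"


subsection \<open>Step 2: global stitching\<close>

definition stitching_cost ::
    "('v::finite \<Rightarrow> 'k set) \<Rightarrow> ('v \<Rightarrow> 'k \<Rightarrow> real ^ 'd) \<Rightarrow> ('v \<Rightarrow> real) \<Rightarrow>
       ('k \<Rightarrow> real ^ 'd) \<times> ('v \<Rightarrow> real) \<times> ('v \<Rightarrow> real ^ 'd) \<Rightarrow> real" where
  "stitching_cost P tloc z =
     (\<lambda>(y, c, s). \<Sum>i \<in> UNIV. \<Sum>k \<in> P i. norm (y k - ((c i * z i) *\<^sub>R tloc i k + s i)))"

definition algorithm_output ::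
    "('v::finite \<Rightarrow> 'k set) \<Rightarrow> ('v \<Rightarrow> 'k \<Rightarrow> real ^ 'd) \<Rightarrow> ('k \<Rightarrow> real ^ 'd) \<Rightarrow> bool" where
  "algorithm_output P tloc y \<longleftrightarrow>
     (\<exists>z. patch_signs P tloc z \<and>
        (\<exists>c s. is_arg_min (stitching_cost P tloc z) (\<lambda>(y, c, s). \<forall>i. 1 \<le> c i) (y, c, s)))"

end

theory Submission
  imports Defs
begin

text \<open>
  On an edge two distinct locations are shared, so the noiseless least squares problem has the
  unique minimizer $c^j / c^i$ (orientation aside) and $\hat z^{ij} = \sigma_i \sigma_j$ with
  $\sigma_i = \mathrm{sign}(c^i)$. Hence $D^{-1}Z$ is the random walk matrix $D^{-1}A$ conjugated by
  $\mathrm{diag}(\sigma)$; its largest eigenvalue is at least 1, and by the maximum principle the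
  eigenvectors for such an eigenvalue are the multiples of $\sigma$. Up to a global sign, the patch
  signs are therefore $\sigma$, so that a large multiple of the true configuration is feasible in
  the stitching program and has cost 0. Every minimizer has cost 0, that is, on each patch its
  locations are an affine image (with nonzero scale) of the true ones, and the affine maps of
  adjacent patches agree because they agree at two distinct points.
\<close>

section \<open>Affine maps and minimizers of cost zero\<close>

lemma affine_map_determined:
  fixes p q b b' :: "'a::real_vector"
  assumes "p \<noteq> q" "a *\<^sub>R p + b = a' *\<^sub>R p + b'" "a *\<^sub>R q + b = a' *\<^sub>R q + b'"
  shows "a = a'" "b = b'"
proof -
  have "(a *\<^sub>R p + b) - (a *\<^sub>R q + b) = (a' *\<^sub>R p + b') - (a' *\<^sub>R q + b')"
    using assms by simp
  then have "a *\<^sub>R (p - q) = a' *\<^sub>R (p - q)"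
    by (simp add: scaleR_diff_right)
  then show "a = a'" using assms(1) by simp
  then show "b = b'" using assms(2) by simp
qed

text \<open>Spares solving either minimization problem: one feasible point of cost 0 fixes the cost
  of every minimizer.\<close>

lemma is_arg_min_zero:
  fixes f :: "'a \<Rightarrow> real"
  assumes "is_arg_min f Q x" "\<And>u. 0 \<le> f u" "Q w" "f w = 0"
  shows "f x = 0"
  using assms(2)[of x] assms by (fastforce simp: is_arg_min_def)

lemma alignment_cost_nonneg: "0 \<le> alignment_cost P tloc i j u"
  by (cases u) (simp add: alignment_cost_def sum_nonneg)

lemma stitching_cost_nonneg: "0 \<le> stitching_cost P tloc z u"
  by (cases u) (simp add: stitching_cost_def sum_nonneg)

section \<open>Connectedness of the patch graph\<close>

text \<open>Induction along a path. Every use of connectedness goes through this, with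
  \<open>f\<close> a truth value (membership in a set closed under adjacency) or a pair of affine
  parameters.\<close>

lemma connected_constant:
  assumes conn: "Digraph_Component.connected (with_proj (patch_graph P))"
    and step: "\<And>i j. (i, j) \<in> parcs (patch_graph P) \<Longrightarrow> f i = f j"
  shows "f i = f j"
proof -
  let ?G = "with_proj (patch_graph P)"
  have "(i, j) \<in> (arcs_ends (with_proj (mk_symmetric ?G)))\<^sup>*"
    using conn unfolding Digraph_Component.connected_def strongly_connected_def
    by (intro reachable_rtranclI) (simp add: mk_symmetric_def patch_graph_def)
  then show ?thesis
  proof induction
    case (step k l)
    then have "(k, l) \<in> parcs (patch_graph P) \<or> (l, k) \<in> parcs (patch_graph P)"
      by (auto simp: arcs_ends_def arc_to_ends_def mk_symmetric_def)
    then show ?case using step assms(2) by metis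
  qed simp
qed

lemma patch_graph_neighbour_exists:
  fixes P :: "'v::finite \<Rightarrow> 'k set"
  assumes conn: "Digraph_Component.connected (with_proj (patch_graph P))" and "CARD('v) \<noteq> 1"
  shows "\<exists>j. (i, j) \<in> parcs (patch_graph P)"
proof (rule ccontr)
  assume isolated: "\<not> ?thesis"
  \<comment> \<open>If \<open>i\<close> is isolated, being equal to \<open>i\<close> is preserved
    across every edge.\<close>
  have "(k = i) = (i = i)" for k
    by (rule connected_constant[OF conn, where f = "\<lambda>k. k = i"])
      (use isolated in \<open>auto simp: patch_graph_def Int_commute\<close>)
  then have "UNIV = {i}" by auto
  then show False using assms(2) by (metis card.empty card.insert empty_iff finite.emptyI One_nat_def)
qed

section \<open>Degree and sign matrices\<close>

lemma out_degree_patch_graph: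
  fixes P :: "'v::finite \<Rightarrow> 'k set"
  shows "out_degree (with_proj (patch_graph P)) i = card {j. (i, j) \<in> parcs (patch_graph P)}"
proof -
  have "out_arcs (with_proj (patch_graph P)) i = Pair i ` {j. (i, j) \<in> parcs (patch_graph P)}"
    by (auto simp: out_arcs_def)
  then show ?thesis
    by (simp add: out_degree_def card_image inj_on_def)
qed

lemma degree_matrix_inverse:
  fixes P :: "'v::finite \<Rightarrow> 'k set"
  assumes "Digraph_Component.connected (with_proj (patch_graph P))" "CARD('v) \<noteq> 1"
  shows "degree_matrix P ** matrix_inv (degree_matrix P) = mat 1"
    and "matrix_inv (degree_matrix P) ** degree_matrix P = mat 1"
proof -
  let ?d = "\<lambda>i. real (out_degree (with_proj (patch_graph P)) i)"
  have nz: "?d i \<noteq> 0" for i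
    using patch_graph_neighbour_exists[OF assms, of i]
    by (auto simp: out_degree_patch_graph)
  have "degree_matrix P ** (\<chi> i j. if i = j then 1 / ?d i else 0) = mat 1"
    using nz by (simp add: degree_matrix_def matrix_matrix_mult_def mat_def vec_eq_iff
        mult_delta_left)
  then have "invertible (degree_matrix P)"
    using invertible_right_inverse by blast
  \<comment> \<open>\<open>matrix_inv\<close> is defined by choice, so the existence of a two-sided
    inverse yields its properties.\<close>
  then have "\<exists>B. degree_matrix P ** B = mat 1 \<and> B ** degree_matrix P = mat 1"
    by (auto simp: invertible_def)
  then have "degree_matrix P ** matrix_inv (degree_matrix P) = mat 1 \<and>
      matrix_inv (degree_matrix P) ** degree_matrix P = mat 1"
    unfolding matrix_inv_def by (rule someI_ex)
  then show "degree_matrix P ** matrix_inv (degree_matrix P) = mat 1"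
    and "matrix_inv (degree_matrix P) ** degree_matrix P = mat 1" by auto
qed

lemma degree_matrix_mult_vec:
  fixes P :: "'v::finite \<Rightarrow> 'k set"
  shows "(degree_matrix P *v x) $ i = real (card {j. (i, j) \<in> parcs (patch_graph P)}) * x $ i"
  by (simp add: degree_matrix_def matrix_vector_mult_def out_degree_patch_graph mult_delta_left)

lemma sign_matrix_mult_vec:
  fixes P :: "'v::finite \<Rightarrow> 'k set"
  shows "(sign_matrix P zr *v x) $ i = (\<Sum>j \<in> {j. (i, j) \<in> parcs (patch_graph P)}. zr i j * x $ j)"
  by (simp add: sign_matrix_def matrix_vector_mult_def mult_delta_left sum.If_cases)

section \<open>Maximum principle on the patch graph\<close>

text \<open>Where a nonnegative maximum is attained, \<open>l\<close> \<ge> 1 makes the neighbours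
  sum to at least the degree times the maximum. So all neighbours attain it too, and it spreads over
  the graph.\<close>

lemma harmonic_constant:
  fixes P :: "'v::finite \<Rightarrow> 'k set" and u :: "'v \<Rightarrow> real"
  defines "N \<equiv> \<lambda>i. {j. (i, j) \<in> parcs (patch_graph P)}"
  assumes conn: "Digraph_Component.connected (with_proj (patch_graph P))"
    and "1 \<le> l" and eig: "\<And>i. (\<Sum>j \<in> N i. u j) = l * (real (card (N i)) * u i)"
  shows "u i = u j"
proof -
  have max_principle: "w i = w j"
    if eig: "\<And>i. (\<Sum>j \<in> N i. w j) = l * (real (card (N i)) * w i)"
      and max: "\<And>j. w j \<le> w m" and pos: "0 \<le> w m" for w m i j
  proof -
    have closed: "w b = w m" if "(a, b) \<in> parcs (patch_graph P)" "w a = w m" for a b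
    proof -
      have "(\<Sum>j \<in> N a. w m - w j) = real (card (N a)) * w m - l * (real (card (N a)) * w m)"
        using that(2) eig[of a] by (simp add: sum_subtractf)
      also have "\<dots> \<le> 0"
        using mult_right_mono[OF \<open>1 \<le> l\<close>, of "real (card (N a)) * w m"] pos by simp
      finally have "(\<Sum>j \<in> N a. w m - w j) = 0"
        using max by (intro antisym sum_nonneg) auto
      then have "\<forall>j \<in> N a. w m - w j = 0"
        using max by (subst (asm) sum_nonneg_eq_0_iff) auto
      then show ?thesis using that(1) by (simp add: N_def)
    qed
    have "(w k = w m) = (w m = w m)" for k
    proof (rule connected_constant[OF conn, where f = "\<lambda>k. w k = w m"])
      fix a b assume "(a, b) \<in> parcs (patch_graph P)"
      then have "(b, a) \<in> parcs (patch_graph P)" "(a, b) \<in> parcs (patch_graph P)"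
        by (auto simp: patch_graph_def Int_commute)
      then show "(w a = w m) = (w b = w m)" using closed by blast
    qed
    then show ?thesis by metis
  qed
  \<comment> \<open>Maximizing the absolute value ensures that \<open>u\<close> or its negative has
    a nonnegative maximum at \<open>m\<close>.\<close>
  obtain m where m: "\<And>j. \<bar>u j\<bar> \<le> \<bar>u m\<bar>"
    using ex_is_arg_min_if_finite[of UNIV "\<lambda>i. - \<bar>u i\<bar>"]
    by (auto simp: is_arg_min_linorder)
  show ?thesis
  proof (cases "0 \<le> u m")
    case True
    have "u j \<le> u m" for j using m[of j] True by linarith
    then show ?thesis using max_principle[OF eig] True by blast
  next
    case False
    have "- u j \<le> - u m" for j using m[of j] False by linarith
    then have "- u i = - u j"
      using max_principle[of "\<lambda>i. - u i" m] False eig by (simp add: sum_negf)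
    then show ?thesis by simp
  qed
qed

section \<open>Noiseless data with fixed true scales and translations\<close>

context
  fixes P :: "'v::finite \<Rightarrow> 'k set" and t :: "'k \<Rightarrow> real ^ 'd"
    and tloc :: "'v \<Rightarrow> 'k \<Rightarrow> real ^ 'd" and c :: "'v \<Rightarrow> real" and s :: "'v \<Rightarrow> real ^ 'd"
  assumes fin: "\<And>i. finite (P i)" and inj: "inj_on t (\<Union>i. P i)"
    and c0: "\<And>i. c i \<noteq> 0" and loc: "\<And>i k. k \<in> P i \<Longrightarrow> t k = c i *\<^sub>R tloc i k + s i"
    and conn: "Digraph_Component.connected (with_proj (patch_graph P))"
begin

lemma tloc_eq: "k \<in> P i \<Longrightarrow> tloc i k = (1 / c i) *\<^sub>R (t k - s i)"
  using loc[of k i] c0[of i] by simp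

lemma edge_shares_two_locations:
  assumes "(i, j) \<in> parcs (patch_graph P)"
  obtains k l where "k \<in> P i" "k \<in> P j" "l \<in> P i" "l \<in> P j" "t k \<noteq> t l"
proof -
  have "2 \<le> card (P i \<inter> P j)" using assms by (simp add: patch_graph_def)
  then obtain k l where "k \<in> P i \<inter> P j" "l \<in> P i \<inter> P j" "k \<noteq> l"
    by (auto simp: numeral_2_eq_2 card_le_Suc_iff)
  moreover have "t k \<noteq> t l" using calculation inj by (auto dest: inj_onD)
  ultimately show ?thesis using that by blast
qed

section \<open>Step 1: recovery of the signs\<close>

lemma pairwise_sign_noiseless:
  assumes "(i, j) \<in> parcs (patch_graph P)" "pairwise_sign P tloc i j z"
  shows "z = sgn (c i) * sgn (c j)"
proof -
  obtain a b where min: "is_arg_min (alignment_cost P tloc i j) (\<lambda>_. True) (a, b)"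
    and sign: "is_sign a z"
    using assms(2) by (auto simp: pairwise_sign_def)
  \<comment> \<open>Equate the two expressions for \<open>t k\<close> coming from patches
    \<open>i\<close> and \<open>j\<close>, and solve for \<open>tloc i k\<close>.\<close>
  have exact: "tloc i k = (c j / c i) *\<^sub>R tloc j k + (1 / c i) *\<^sub>R (s j - s i)"
    if "k \<in> P i" "k \<in> P j" for k
    using tloc_eq[OF that(1)] loc[OF that(2)] by (simp add: algebra_simps)
  have "alignment_cost P tloc i j (c j / c i, (1 / c i) *\<^sub>R (s j - s i)) = 0"
    using exact by (auto simp: alignment_cost_def intro!: sum.neutral)
  then have "alignment_cost P tloc i j (a, b) = 0"
    using is_arg_min_zero[OF min alignment_cost_nonneg] by blast
  then have ab: "tloc i k = a *\<^sub>R tloc j k + b" if "k \<in> P i" "k \<in> P j" for k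
    using that fin by (auto simp: alignment_cost_def sum_nonneg_eq_0_iff)
  obtain k l where kl: "k \<in> P i" "k \<in> P j" "l \<in> P i" "l \<in> P j" "t k \<noteq> t l"
    by (rule edge_shares_two_locations[OF assms(1)])
  have "tloc j k \<noteq> tloc j l" using loc[OF kl(2)] loc[OF kl(4)] kl(5) by auto
  then have "a = c j / c i"
    using ab exact kl by (intro affine_map_determined(1)[of "tloc j k" "tloc j l"
          a b "c j / c i" "(1 / c i) *\<^sub>R (s j - s i)"]) metis+
  then show ?thesis
    using sign c0[of i] c0[of j]
    by (cases "0 < c i"; cases "0 < c j") (auto simp: is_sign_def sgn_divide)
qed

text \<open>The product of the two signs is symmetric, so it does not matter which orientation of
  the edge was solved.\<close>

lemma relative_signs_noiseless:
  assumes "relative_signs P tloc zr" "(i, j) \<in> parcs (patch_graph P)"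
  shows "zr i j = sgn (c i) * sgn (c j)"
proof -
  have "(j, i) \<in> parcs (patch_graph P)"
    using assms(2) by (auto simp: patch_graph_def Int_commute)
  then show ?thesis
    using assms pairwise_sign_noiseless[of i j "zr i j"] pairwise_sign_noiseless[of j i "zr i j"]
    by (auto simp: relative_signs_def mult.commute)
qed

text \<open>The factor \<open>e\<close> is the global sign left open because an eigenvector is
  determined only up to scaling.\<close>

lemma patch_signs_noiseless:
  assumes "patch_signs P tloc z"
  obtains e where "e \<in> {-1, 1}" "\<And>i. z i = e * sgn (c i)"
proof (cases "CARD('v) = 1")
  case True
  then obtain i0 :: 'v where "UNIV = {i0}" using card_1_singletonE by metis
  then have single: "i = i0" for i by auto
  have "z i0 \<in> {-1, 1}" using assms True by (auto simp: patch_signs_def)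
  then have "z i0 * sgn (c i0) \<in> {-1, 1}" "z i = z i0 * sgn (c i0) * sgn (c i)" for i
    using c0[of i0] single[of i] by (auto simp: sgn_if)
  then show ?thesis using that by blast
next
  case False
  let ?N = "\<lambda>i. {j. (i, j) \<in> parcs (patch_graph P)}"
  have sgn_sq: "sgn (c i) * sgn (c i) = 1" for i using c0[of i] by (simp add: sgn_if)
  obtain zr v where zr: "relative_signs P tloc zr"
    and top: "is_top_eigenvector (matrix_inv (degree_matrix P) ** sign_matrix P zr) v"
    and sign: "\<And>i. is_sign (v $ i) (z i)"
    using assms False by (auto simp: patch_signs_def)
  let ?D = "degree_matrix P" and ?Z = "sign_matrix P zr"
  let ?A = "matrix_inv ?D ** ?Z"
  note inv = degree_matrix_inverse[OF conn False]
  define \<sigma> :: "real ^ 'v" where "\<sigma> = (\<chi> i. sgn (c i))"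
  have Z: "(?Z *v x) $ i = sgn (c i) * (\<Sum>j \<in> ?N i. sgn (c j) * x $ j)" for x i
    unfolding sign_matrix_mult_vec sum_distrib_left
    by (rule sum.cong) (auto simp: relative_signs_noiseless[OF zr] mult.assoc)
  \<comment> \<open>Each neighbour \<open>j\<close> contributes
    \<open>sgn (c j) * sgn (c j) = 1\<close>, so the inner sum is the degree. This makes 1 an
    eigenvalue and gives \<open>1 \<le> l\<close> for the largest one.\<close>
  have "?Z *v \<sigma> = ?D *v \<sigma>"
    unfolding vec_eq_iff by (simp only: Z degree_matrix_mult_vec \<sigma>_def vec_lambda_beta sgn_sq)
      (simp add: mult.commute)
  then have "?A *v \<sigma> = \<sigma>"
    using inv(2) by (metis matrix_vector_mul_assoc matrix_vector_mul_lid)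
  moreover have "\<sigma> \<noteq> 0" using c0 by (auto simp: \<sigma>_def vec_eq_iff sgn_if)
  ultimately have "is_eigenvector ?A \<sigma> 1" by (simp add: is_eigenvector_def)
  then obtain l where v: "v \<noteq> 0" "?A *v v = l *\<^sub>R v" and l: "1 \<le> l"
    using top unfolding is_top_eigenvector_def is_eigenvector_def by blast
  have "?Z *v v = ?D *v (?A *v v)"
    using inv(1) by (metis matrix_vector_mul_assoc matrix_vector_mul_lid matrix_mul_assoc)
  then have "?Z *v v = l *\<^sub>R (?D *v v)"
    by (simp add: v(2) matrix_vector_mult_scaleR)
  then have eig: "sgn (c i) * (\<Sum>j \<in> ?N i. sgn (c j) * v $ j) = l * (real (card (?N i)) * v $ i)" for i
    by (metis Z degree_matrix_mult_vec vector_scaleR_component real_scaleR_def)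
  \<comment> \<open>Multiplying by \<open>sgn (c i)\<close> removes the signs: the function
    \<open>sgn (c i) * v $ i\<close> satisfies the equation of the maximum principle.\<close>
  have "(\<Sum>j \<in> ?N i. sgn (c j) * v $ j) = l * (real (card (?N i)) * (sgn (c i) * v $ i))" for i
  proof -
    have "(\<Sum>j \<in> ?N i. sgn (c j) * v $ j) =
        sgn (c i) * (sgn (c i) * (\<Sum>j \<in> ?N i. sgn (c j) * v $ j))"
      by (simp only: sgn_sq mult_1 flip: mult.assoc)
    also have "\<dots> = l * (real (card (?N i)) * (sgn (c i) * v $ i))"
      unfolding eig by (simp only: ac_simps)
    finally show ?thesis .
  qed
  then have const: "sgn (c i) * v $ i = sgn (c j) * v $ j" for i j
    by (intro harmonic_constant[OF conn l, of "\<lambda>i. sgn (c i) * v $ i"]) auto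
  obtain i0 where "v $ i0 \<noteq> 0" using v(1) by (auto simp: vec_eq_iff)
  define a where "a = sgn (c i0) * v $ i0"
  \<comment> \<open>With \<open>a\<close> nonzero, no component of \<open>v\<close> vanishes, so
    \<open>z\<close> consists of the true signs of \<open>v\<close>.\<close>
  have a0: "a \<noteq> 0" using \<open>v $ i0 \<noteq> 0\<close> c0 by (simp add: a_def sgn_if)
  have va: "v $ i = a * sgn (c i)" for i
    using const[of i i0] sgn_sq[of i] unfolding a_def by (metis mult.assoc mult.commute mult_1)
  have "z i = sgn a * sgn (c i)" for i
    using sign[of i] a0 c0[of i] by (auto simp: is_sign_def va sgn_mult sgn_0_0)
  moreover have "sgn a \<in> {-1, 1}" using a0 by (simp add: sgn_if)
  ultimately show ?thesis using that by blast
qed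

section \<open>Step 2: stitching and recovery\<close>

lemma stitching_cost_zero_attained:
  assumes "e \<in> {-1, 1}" "\<And>i. z i = e * sgn (c i)"
  shows "\<exists>y' c' s'. (\<forall>i. 1 \<le> c' i) \<and> stitching_cost P tloc z (y', c', s') = 0"
proof -
  obtain m where m: "\<And>i. \<bar>c m\<bar> \<le> \<bar>c i\<bar>"
    using ex_is_arg_min_if_finite[of UNIV "\<lambda>i. \<bar>c i\<bar>"] by (auto simp: is_arg_min_linorder)
  \<comment> \<open>This factor scales the smallest \<open>\<bar>c i\<bar>\<close> to 1, which makes
    all scales feasible.\<close>
  define M where "M = 1 / \<bar>c m\<bar>"
  have "1 \<le> M * \<bar>c i\<bar>" for i using m[of i] c0[of m] by (simp add: M_def)
  moreover have "stitching_cost P tloc z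
      (\<lambda>k. (M * e) *\<^sub>R t k, \<lambda>i. M * \<bar>c i\<bar>, \<lambda>i. (M * e) *\<^sub>R s i) = 0"
  proof -
    have "M * \<bar>c i\<bar> * z i = M * e * c i" for i
      using assms(2)[of i] by (simp add: sgn_if)
    then have "(M * e) *\<^sub>R t k = (M * \<bar>c i\<bar> * z i) *\<^sub>R tloc i k + (M * e) *\<^sub>R s i" if "k \<in> P i" for i k
      by (simp only: loc[OF that] scaleR_add_right scaleR_scaleR)
    then show ?thesis by (simp add: stitching_cost_def)
  qed
  ultimately show ?thesis
    by (intro exI[of _ "\<lambda>k. (M * e) *\<^sub>R t k"] exI[of _ "\<lambda>i. M * \<bar>c i\<bar>"]
        exI[of _ "\<lambda>i. (M * e) *\<^sub>R s i"]) simp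
qed

text \<open>Two distinct shared locations force adjacent patches to have the same affine map;
  connectedness then leaves a single map, whose inverse is the congruence from \<open>y\<close> to
  \<open>t\<close>.\<close>

lemma patchwise_affine_congruent:
  assumes patch: "\<And>i k. k \<in> P i \<Longrightarrow> y k = a i *\<^sub>R t k + b i" and a0: "\<And>i. a i \<noteq> 0"
  shows "congruent_locations (\<Union>i. P i) y t"
proof -
  have "(a i, b i) = (a j, b j)" if edge: "(i, j) \<in> parcs (patch_graph P)" for i j
  proof -
    obtain k l where kl: "k \<in> P i" "k \<in> P j" "l \<in> P i" "l \<in> P j" "t k \<noteq> t l"
      by (rule edge_shares_two_locations[OF edge])
    then have "a i *\<^sub>R t k + b i = a j *\<^sub>R t k + b j" "a i *\<^sub>R t l + b i = a j *\<^sub>R t l + b j"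
      using patch by metis+
    then show ?thesis using affine_map_determined[OF kl(5)] by blast
  qed
  then have const: "(a i, b i) = (a j, b j)" for i j
    by (rule connected_constant[OF conn, where f = "\<lambda>i. (a i, b i)"])
  \<comment> \<open>Names an arbitrary patch, whose affine map stands for all of them.\<close>
  obtain i0 :: 'v where True by simp
  have "t k = (1 / a i0) *\<^sub>R y k + - ((1 / a i0) *\<^sub>R b i0)" if "k \<in> P i" for i k
    using patch[OF that] const[of i i0] a0[of i0] by (simp add: scaleR_add_right)
  then show ?thesis
    unfolding congruent_locations_def using a0[of i0]
    by (intro exI[of _ "1 / a i0"] exI[of _ "- ((1 / a i0) *\<^sub>R b i0)"]) auto
qed

lemma noiseless_recovery:
  assumes "algorithm_output P tloc y"
  shows "congruent_locations (\<Union>i. P i) y t"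
proof -
  obtain z c' s' where z: "patch_signs P tloc z"
    and min: "is_arg_min (stitching_cost P tloc z) (\<lambda>(y, c, s). \<forall>i. 1 \<le> c i) (y, c', s')"
    using assms by (auto simp: algorithm_output_def)
  obtain e where e: "e \<in> {-1, 1}" "\<And>i. z i = e * sgn (c i)"
    by (rule patch_signs_noiseless[OF z]) blast
  have "stitching_cost P tloc z (y, c', s') = 0"
    using stitching_cost_zero_attained[OF e] is_arg_min_zero[OF min stitching_cost_nonneg] by blast
  then have "y k = (c' i * z i) *\<^sub>R tloc i k + s' i" if "k \<in> P i" for i k
    using that fin by (auto simp: stitching_cost_def sum_nonneg_eq_0_iff sum_nonneg)
  then have "y k = (c' i * z i / c i) *\<^sub>R t k + (s' i - (c' i * z i / c i) *\<^sub>R s i)"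
    if "k \<in> P i" for i k
    using that by (simp add: tloc_eq algebra_simps)
  moreover have "c' i * z i / c i \<noteq> 0" for i
  proof -
    \<comment> \<open>The constraint excludes collapsing all locations to one point, which would
      also have cost 0.\<close>
    have "1 \<le> c' i" using min by (auto simp: is_arg_min_def)
    then show ?thesis using e c0[of i] by (auto simp: sgn_if)
  qed
  ultimately show ?thesis by (rule patchwise_affine_congruent)
qed

end

theorem proposition3p1:
  fixes P :: "'v::finite \<Rightarrow> 'k set"
    and t :: "'k \<Rightarrow> real ^ 'd"
    and tloc :: "'v \<Rightarrow> 'k \<Rightarrow> real ^ 'd"
    and y :: "'k \<Rightarrow> real ^ 'd"
  assumes "2 \<le> CARD('d)"
    and "\<And>i. finite (P i)"
    and "inj_on t (\<Union>i. P i)"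
    and "local_coordinates P t tloc"
    and "Digraph_Component.connected (with_proj (patch_graph P))"
    and "algorithm_output P tloc y"
  shows "congruent_locations (\<Union>i. P i) y t"
proof -
  obtain c s where "\<And>i. c i \<noteq> 0" "\<And>i k. k \<in> P i \<Longrightarrow> t k = c i *\<^sub>R tloc i k + s i"
    using assms(4) unfolding local_coordinates_def by blast
  then show ?thesis using assms by (intro noiseless_recovery) auto
qed

end
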